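(* If a braced P-framework $(G,\rho)$ is such that $G$ has a cartesian NAC-coloring, then $(G,\rho)$ is flexible.
   Context: A placement of a connected graph $G$ is a map $\rho:V_G\to\mathbb{R}^2$ with $\rho(u)\neq\rho(v)$ for all edges $uv$. A flex of $(G,\rho)$ is a continuous path $t\mapsto\rho_t$, $t\in[0,1]$, of placements with $\rho_0=\rho$ preserving all edge lengths $\|\rho_t(u)-\rho_t(v)\|$, $uv\in E_G$; it is trivial if every $\rho_t$ is congruent to $\rho$ via a Euclidean isometry. The framework is flexible if it has a non-trivial flex. For a graph $H$, two edges are related if they are opposite edges of a 4-cycle subgraph of $H$; a ribbon of $H$ is an equivalence class of the reflexive–transitive closure of this relation. A ribbon-cutting graph is a connected graph in which every ribbon is an edge cut (its removal disconnects the graph). A parallelogram placement of a connected graph $H$ is an injective map $\rho:V_H\to\mathbb{R}^2$ such that every 4-cycle $(u_1,u_2,u_3,u_4)$ of $H$ satisfies $\rho(u_2)-\rho(u_1)=\rho(u_3)-\rho(u_4)$. A braced ribbon-cutting graph is a graph $G=(V_G,E_c\cup E_d)$, where $E_c,E_d$ are non-empty disjoint sets, $(V_G,E_c)$ is ribbon-cutting, and every edge of $E_d$ (a brace) is a diagonal $u_1u_3$ of some 4-cycle $(u_1,u_2,u_3,u_4)$ of $(V_G,E_c)$. A braced P-framework is a framework $(G,\rho)$ with $G$ a braced ribbon-cutting graph and $\rho$ a parallelogram placement of $(V_G,E_c)$. A NAC-coloring of $G$ is a surjective map $\delta:E_G\to\{\text{red},\text{blue}\}$ such that every cycle is monochromatic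 or contains at least two edges of each color; it is cartesian if no two distinct vertices are connected by both a red path and a blue path. *)

theory Defs
  imports "HOL-Analysis.Analysis"
begin

text \<open>
  A simple undirected graph is given by a vertex set \<open>V\<close> and a set \<open>E\<close> of two-element
  subsets of \<open>V\<close>. Finiteness is not assumed. Maps defined on \<open>V\<close> or \<open>E\<close> are total
  functions of which only the values on \<open>V\<close> or \<open>E\<close> are ever used.
\<close>

definition simple_graph :: "'v set \<Rightarrow> 'v set set \<Rightarrow> bool" where
  "simple_graph V E \<longleftrightarrow> E \<subseteq> {{u, v} | u v. u \<in> V \<and> v \<in> V \<and> u \<noteq> v}"

definition graph_path :: "'v set set \<Rightarrow> 'v list \<Rightarrow> bool" where
  "graph_path E p \<longleftrightarrow> p \<noteq> [] \<and> distinct p \<and> successively (\<lambda>u v. {u, v} \<in> E) p"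

definition joined :: "'v set set \<Rightarrow> 'v \<Rightarrow> 'v \<Rightarrow> bool" where
  "joined E u v \<longleftrightarrow> (\<exists>p. graph_path E p \<and> hd p = u \<and> last p = v)"

definition connected_graph :: "'v set \<Rightarrow> 'v set set \<Rightarrow> bool" where
  "connected_graph V E \<longleftrightarrow>
     simple_graph V E \<and> V \<noteq> {} \<and> (\<forall>u\<in>V. \<forall>v\<in>V. joined E u v)"

text \<open>A cycle is the list of its vertices; the last vertex is adjacent to the first one.\<close>

definition cycle_edges :: "'v list \<Rightarrow> 'v set set" where
  "cycle_edges p = {{p ! i, p ! ((i + 1) mod length p)} | i. i < length p}"

definition graph_cycle :: "'v set set \<Rightarrow> 'v list \<Rightarrow> bool" where
  "graph_cycle E p \<longleftrightarrow> length p \<ge> 3 \<and> distinct p \<and> cycle_edges p \<subseteq> E"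

definition placement :: "'v set \<Rightarrow> 'v set set \<Rightarrow> ('v \<Rightarrow> real^2) \<Rightarrow> bool" where
  "placement V E \<rho> \<longleftrightarrow> (\<forall>u\<in>V. \<forall>v\<in>V. {u, v} \<in> E \<longrightarrow> \<rho> u \<noteq> \<rho> v)"

definition framework :: "'v set \<Rightarrow> 'v set set \<Rightarrow> ('v \<Rightarrow> real^2) \<Rightarrow> bool" where
  "framework V E \<rho> \<longleftrightarrow> connected_graph V E \<and> placement V E \<rho>"

text \<open>
  Continuity of a path of placements is continuity of each vertex trajectory, that is, continuity
  for the product topology (the Euclidean topology of \<open>(\<real>\<^sup>2)\<^sup>V\<close> when \<open>V\<close> is finite).
\<close>

definition flex ::
  "'v set \<Rightarrow> 'v set set \<Rightarrow> ('v \<Rightarrow> real^2) \<Rightarrow> (real \<Rightarrow> 'v \<Rightarrow> real^2) \<Rightarrow> bool" where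
  "flex V E \<rho> f \<longleftrightarrow>
     (\<forall>v\<in>V. continuous_on {0..1} (\<lambda>t. f t v)) \<and>
     (\<forall>t\<in>{0..1}. placement V E (f t)) \<and>
     (\<forall>v\<in>V. f 0 v = \<rho> v) \<and>
     (\<forall>t\<in>{0..1}. \<forall>u\<in>V. \<forall>v\<in>V. {u, v} \<in> E \<longrightarrow> norm (f t u - f t v) = norm (\<rho> u - \<rho> v))"

definition congruent_placements ::
  "'v set \<Rightarrow> ('v \<Rightarrow> real^2) \<Rightarrow> ('v \<Rightarrow> real^2) \<Rightarrow> bool" where
  "congruent_placements V \<rho> \<sigma> \<longleftrightarrow>
     (\<exists>T :: real^2 \<Rightarrow> real^2. (\<forall>x y. dist (T x) (T y) = dist x y) \<and> (\<forall>v\<in>V. \<sigma> v = T (\<rho> v)))"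

definition trivial_flex ::
  "'v set \<Rightarrow> ('v \<Rightarrow> real^2) \<Rightarrow> (real \<Rightarrow> 'v \<Rightarrow> real^2) \<Rightarrow> bool" where
  "trivial_flex V \<rho> f \<longleftrightarrow> (\<forall>t\<in>{0..1}. congruent_placements V \<rho> (f t))"

definition flexible :: "'v set \<Rightarrow> 'v set set \<Rightarrow> ('v \<Rightarrow> real^2) \<Rightarrow> bool" where
  "flexible V E \<rho> \<longleftrightarrow> (\<exists>f. flex V E \<rho> f \<and> \<not> trivial_flex V \<rho> f)"

text \<open>
  The other pair of opposite edges of a 4-cycle is covered by the rotated list
  \<open>[u2, u3, u4, u1]\<close>, which is again a 4-cycle.
\<close>

definition opposite_edges :: "'v set set \<Rightarrow> ('v set \<times> 'v set) set" where
  "opposite_edges E =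
     {({u1, u2}, {u3, u4}) | u1 u2 u3 u4. graph_cycle E [u1, u2, u3, u4]}"

definition ribbons :: "'v set set \<Rightarrow> 'v set set set" where
  "ribbons E = E // (opposite_edges E)\<^sup>*"

definition ribbon_cutting_graph :: "'v set \<Rightarrow> 'v set set \<Rightarrow> bool" where
  "ribbon_cutting_graph V E \<longleftrightarrow>
     connected_graph V E \<and> (\<forall>r\<in>ribbons E. \<not> connected_graph V (E - r))"

definition parallelogram_placement :: "'v set \<Rightarrow> 'v set set \<Rightarrow> ('v \<Rightarrow> real^2) \<Rightarrow> bool" where
  "parallelogram_placement V E \<rho> \<longleftrightarrow>
     inj_on \<rho> V \<and>
     (\<forall>u1 u2 u3 u4. graph_cycle E [u1, u2, u3, u4] \<longrightarrow> \<rho> u2 - \<rho> u1 = \<rho> u3 - \<rho> u4)"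

definition braced_ribbon_cutting_graph :: "'v set \<Rightarrow> 'v set set \<Rightarrow> 'v set set \<Rightarrow> bool" where
  "braced_ribbon_cutting_graph V Ec Ed \<longleftrightarrow>
     Ec \<noteq> {} \<and> Ed \<noteq> {} \<and> Ec \<inter> Ed = {} \<and>
     ribbon_cutting_graph V Ec \<and>
     (\<forall>e\<in>Ed. \<exists>u1 u2 u3 u4. graph_cycle Ec [u1, u2, u3, u4] \<and> e = {u1, u3})"

definition braced_P_framework ::
  "'v set \<Rightarrow> 'v set set \<Rightarrow> 'v set set \<Rightarrow> ('v \<Rightarrow> real^2) \<Rightarrow> bool" where
  "braced_P_framework V Ec Ed \<rho> \<longleftrightarrow>
     framework V (Ec \<union> Ed) \<rho> \<and>
     braced_ribbon_cutting_graph V Ec Ed \<and>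
     parallelogram_placement V Ec \<rho>"

datatype edge_color = Red | Blue

definition NAC_coloring :: "'v set set \<Rightarrow> ('v set \<Rightarrow> edge_color) \<Rightarrow> bool" where
  "NAC_coloring E \<delta> \<longleftrightarrow>
     \<delta> ` E = {Red, Blue} \<and>
     (\<forall>p. graph_cycle E p \<longrightarrow>
        (\<exists>c. \<forall>e\<in>cycle_edges p. \<delta> e = c) \<or>
        (\<forall>c. card {e \<in> cycle_edges p. \<delta> e = c} \<ge> 2))"

definition cartesian_NAC_coloring ::
  "'v set \<Rightarrow> 'v set set \<Rightarrow> ('v set \<Rightarrow> edge_color) \<Rightarrow> bool" where
  "cartesian_NAC_coloring V E \<delta> \<longleftrightarrow>
     NAC_coloring E \<delta> \<and>
     \<not> (\<exists>u\<in>V. \<exists>v\<in>V. u \<noteq> v \<and>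
          joined {e \<in> E. \<delta> e = Red} u v \<and> joined {e \<in> E. \<delta> e = Blue} u v)"

end

theory Submission
  imports Defs "HOL-Library.Groups_Big_Fun"
begin

text \<open>
  In a parallelogram placement all edges of a ribbon are translates of one vector \<open>w\<close>, and removing
  the ribbon leaves exactly two components, every edge of the ribbon leading from the first one to
  the second one by \<open>w\<close>. So the edge vectors of a single ribbon, with all other edge vectors
  replaced by 0, are the differences of a potential that is 0 on one component and \<open>w\<close> on the other.
  A cartesian NAC-coloring is constant on ribbons; summing the potentials of the red ribbons gives
  \<open>R\<close> such that the differences of \<open>R\<close> vanish along blue edges and those of \<open>\<rho> - R\<close> along red ones.
  Keeping \<open>R\<close> fixed while rotating \<open>\<rho> - R\<close> preserves the length of each edge; a brace has the color
  of its whole 4-cycle. The flex is non-trivial at a vertex incident with edges of both colors.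
\<close>

section \<open>Walks and paths\<close>

definition adj :: "'v set set \<Rightarrow> ('v \<times> 'v) set" where
  "adj E = {(x, y). {x, y} \<in> E}"

lemma sym_adj: "sym (adj E)"
  by (auto simp: sym_def adj_def insert_commute)

text \<open>A walk can be shortened to a path: when it returns to a vertex already on the path built
  so far, the path is cut off there. This makes the closure properties of \<open>rtrancl\<close>
  available for connectivity.\<close>

lemma joined_iff_adj: "joined E u v \<longleftrightarrow> (u, v) \<in> (adj E)\<^sup>*"
proof
  assume "joined E u v"
  then obtain p where "graph_path E p" "hd p = u" "last p = v"
    by (auto simp: joined_def)
  moreover have "(hd p, last p) \<in> (adj E)\<^sup>*"
    if "p \<noteq> []" "successively (\<lambda>u v. {u, v} \<in> E) p" for p
    using that
  proof (induction p rule: induct_list012)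
    case (3 x y zs)
    then have "(x, y) \<in> adj E" "(y, last (y # zs)) \<in> (adj E)\<^sup>*"
      by (auto simp: adj_def)
    then show ?case by (simp add: converse_rtrancl_into_rtrancl)
  qed auto
  ultimately show "(u, v) \<in> (adj E)\<^sup>*" by (auto simp: graph_path_def)
next
  assume "(u, v) \<in> (adj E)\<^sup>*"
  then show "joined E u v"
  proof (induction rule: rtrancl_induct)
    case base
    show ?case unfolding joined_def graph_path_def by (rule exI[of _ "[u]"]) auto
  next
    case (step v w)
    then obtain p where p: "graph_path E p" "hd p = u" "last p = v"
      by (auto simp: joined_def)
    show ?case
    proof (cases "w \<in> set p")
      case True
      then obtain xs ys where "p = xs @ w # ys" by (meson split_list)
      with p have "graph_path E (xs @ [w])" "hd (xs @ [w]) = u"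
        by (auto simp: graph_path_def successively_append_iff hd_append)
      then show ?thesis unfolding joined_def by (intro exI[of _ "xs @ [w]"]) auto
    next
      case False
      with p step.hyps(2) have "graph_path E (p @ [w])" "hd (p @ [w]) = u"
        by (auto simp: graph_path_def successively_append_iff adj_def)
      then show ?thesis unfolding joined_def by (intro exI[of _ "p @ [w]"]) auto
    qed
  qed
qed

lemma simple_graph_edge:
  assumes "simple_graph V E" "{x, y} \<in> E"
  shows "x \<in> V" "y \<in> V" "x \<noteq> y"
  using assms by (auto simp: simple_graph_def doubleton_eq_iff)

lemma cycle_edges_3: "cycle_edges [a, b, c] = {{a, b}, {b, c}, {c, a}}"
  by (simp add: cycle_edges_def setcompr_eq_image flip: lessThan_def)
    (simp add: lessThan_Suc insert_commute)

lemma cycle_edges_4: "cycle_edges [a, b, c, d] = {{a, b}, {b, c}, {c, d}, {d, a}}"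
  by (simp add: cycle_edges_def setcompr_eq_image flip: lessThan_def)
    (simp add: lessThan_Suc insert_commute)

lemma graph_cycle_3:
  "graph_cycle E [a, b, c] \<longleftrightarrow> distinct [a, b, c] \<and> {a, b} \<in> E \<and> {b, c} \<in> E \<and> {c, a} \<in> E"
  by (auto simp: graph_cycle_def cycle_edges_3)

lemma graph_cycle_4:
  "graph_cycle E [a, b, c, d] \<longleftrightarrow>
     distinct [a, b, c, d] \<and> {a, b} \<in> E \<and> {b, c} \<in> E \<and> {c, d} \<in> E \<and> {d, a} \<in> E"
  by (auto simp: graph_cycle_def cycle_edges_4)

section \<open>Potentials of ribbons\<close>

lemma sym_opposite_edges: "sym (opposite_edges E)"
proof (rule symI)
  fix e f
  assume "(e, f) \<in> opposite_edges E"
  then obtain a b c d where "e = {a, b}" "f = {c, d}" "graph_cycle E [a, b, c, d]"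
    by (auto simp: opposite_edges_def)
  moreover from this have "graph_cycle E [c, d, a, b]" by (auto simp: graph_cycle_4)
  ultimately show "(f, e) \<in> opposite_edges E" unfolding opposite_edges_def by blast
qed

text \<open>Passing from an edge of \<open>r\<close> to its opposite edge in a 4-cycle stays within
  the same components of \<open>E - r\<close> and keeps the vector \<open>w\<close>. So
  \<open>r\<close> runs from the component of \<open>a\<close> to that of \<open>b\<close>, and
  these differ because deleting \<open>r\<close> disconnects the graph.\<close>

lemma ribbon_potential:
  assumes cut: "ribbon_cutting_graph V E" and par: "parallelogram_placement V E \<rho>"
    and r: "r \<in> ribbons E"
  obtains P :: "'v \<Rightarrow> real^2" where
    "\<And>x y. {x, y} \<in> E \<Longrightarrow> P y - P x = (if {x, y} \<in> r then \<rho> y - \<rho> x else 0)"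
proof -
  have conn: "connected_graph V E" and ncon: "\<not> connected_graph V (E - r)"
    using cut r by (auto simp: ribbon_cutting_graph_def)
  then have simple: "simple_graph V E" by (simp add: connected_graph_def)
  have inj: "inj_on \<rho> V" and
    para: "\<And>a b c d. graph_cycle E [a, b, c, d] \<Longrightarrow> \<rho> b - \<rho> a = \<rho> c - \<rho> d"
    using par by (auto simp: parallelogram_placement_def)
  obtain e where e: "e \<in> E" "r = (opposite_edges E)\<^sup>* `` {e}"
    using r unfolding ribbons_def by (auto elim: quotientE)
  obtain a b where ab: "e = {a, b}"
    using e(1) simple by (auto simp: simple_graph_def)
  \<comment> \<open>The edges are unordered, so at first the common vector is known only up to sign;
    \<open>sides\<close> below fixes the orientation.\<close>
  define w where "w = \<rho> b - \<rho> a"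
  have vec: "\<rho> y - \<rho> x = w \<or> \<rho> y - \<rho> x = - w" if "{x, y} \<in> r" for x y
  proof -
    have "(e, {x, y}) \<in> (opposite_edges E)\<^sup>*" using that e(2) by simp
    then have "{x, y} \<in> r \<and> (\<exists>p q. {x, y} = {p, q} \<and> \<rho> q - \<rho> p = w)"
    proof (induction rule: rtrancl_induct)
      case base
      then show ?case using ab w_def e(2) by auto
    next
      case (step f g)
      then obtain p q where pq: "f = {p, q}" "\<rho> q - \<rho> p = w" "f \<in> r" by blast
      obtain u1 u2 u3 u4 where u: "f = {u1, u2}" "g = {u3, u4}" "graph_cycle E [u1, u2, u3, u4]"
        using step.hyps(2) by (auto simp: opposite_edges_def)
      have "g \<in> r" using step.hyps e(2) by (auto intro: rtrancl_into_rtrancl)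
      moreover have "\<rho> u3 - \<rho> u4 = w \<or> \<rho> u4 - \<rho> u3 = w"
        using para[OF u(3)] pq(1,2) u(1) by (auto simp: doubleton_eq_iff algebra_simps)
      ultimately show ?case using u(2) by (metis insert_commute)
    qed
    then obtain p q where "{x, y} = {p, q}" "\<rho> q - \<rho> p = w" by blast
    then show ?thesis by (auto simp: doubleton_eq_iff)
  qed
  \<comment> \<open>Two consecutive edges of a 4-cycle in one ribbon would be equal or opposite vectors, so that
    two vertices of the 4-cycle would coincide.\<close>
  have nadj: "{u2, u3} \<notin> r" if "{u1, u2} \<in> r" "graph_cycle E [u1, u2, u3, u4]" for u1 u2 u3 u4
  proof
    assume "{u2, u3} \<in> r"
    then have "\<rho> u3 = \<rho> u1 \<or> \<rho> u4 = \<rho> u2"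
      using vec[OF that(1)] vec[of u2 u3] para[OF that(2)] by (auto simp: algebra_simps)
    moreover have "distinct [u1, u2, u3, u4]" "{u1, u2, u3, u4} \<subseteq> V"
      using that(2) simple_graph_edge[OF simple] by (auto simp: graph_cycle_4)
    ultimately show False using inj by (auto simp: inj_on_def)
  qed
  define C where "C = (adj (E - r))\<^sup>*"
  have symC: "(y, x) \<in> C" if "(x, y) \<in> C" for x y
    using that sym_adj sym_rtrancl unfolding C_def by (metis symD)
  have transC: "(x, z) \<in> C" if "(x, y) \<in> C" "(y, z) \<in> C" for x y z
    using that unfolding C_def by simp
  have edgeC: "(x, y) \<in> C" if "{x, y} \<in> E" "{x, y} \<notin> r" for x y
    using that unfolding C_def adj_def by auto
  have sides: "\<exists>x y. f = {x, y} \<and> \<rho> y - \<rho> x = w \<and> (a, x) \<in> C \<and> (b, y) \<in> C" if "f \<in> r" for f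
  proof -
    have "(e, f) \<in> (opposite_edges E)\<^sup>*" using that e(2) by simp
    then show ?thesis
    proof (induction rule: rtrancl_induct)
      case base
      then show ?case using ab w_def unfolding C_def by blast
    next
      case (step f g)
      then obtain x y where xy: "f = {x, y}" "\<rho> y - \<rho> x = w" "(a, x) \<in> C" "(b, y) \<in> C" by blast
      obtain u1 u2 u3 u4 where u: "f = {u1, u2}" "g = {u3, u4}" "graph_cycle E [u1, u2, u3, u4]"
        using step.hyps(2) by (auto simp: opposite_edges_def)
      have fr: "f \<in> r" using step.hyps e(2) by simp
      have "graph_cycle E [u2, u1, u4, u3]" using u(3) by (auto simp: graph_cycle_4 insert_commute)
      \<comment> \<open>The two edges leading from \<open>f\<close> to \<open>g\<close> survive the
        deletion of \<open>r\<close>, so corresponding ends of \<open>f\<close> and \<open>g\<close>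
        share a component.\<close>
      then have "{u2, u3} \<notin> r" "{u1, u4} \<notin> r"
        using fr u nadj[of u1 u2 u3 u4] nadj[of u2 u1 u4 u3] by (auto simp: insert_commute)
      then have C: "(u2, u3) \<in> C" "(u1, u4) \<in> C"
        using u(3) edgeC by (auto simp: graph_cycle_4 insert_commute)
      from xy(1) u(1) consider "x = u1" "y = u2" | "x = u2" "y = u1"
        by (auto simp: doubleton_eq_iff)
      then show ?case
      proof cases
        case 1
        then have "\<rho> u3 - \<rho> u4 = w" "(a, u4) \<in> C" "(b, u3) \<in> C"
          using para[OF u(3)] xy transC C by simp_all
        then show ?thesis using u(2) by (metis insert_commute)
      next
        case 2
        then have "\<rho> u4 - \<rho> u3 = w" "(a, u3) \<in> C" "(b, u4) \<in> C"
          using para[OF u(3)] xy transC C by (simp_all add: algebra_simps)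
        then show ?thesis using u(2) by metis
      qed
    qed
  qed
  \<comment> \<open>Otherwise each edge of \<open>r\<close> could be bypassed through
    \<open>a\<close> and \<open>b\<close>, and deleting \<open>r\<close> would not disconnect the
    graph.\<close>
  have nC: "(a, b) \<notin> C"
  proof
    assume "(a, b) \<in> C"
    then have "(x, y) \<in> C" if "{x, y} \<in> E" for x y
    proof (cases "{x, y} \<in> r")
      case True
      then obtain p q where "{x, y} = {p, q}" "(a, p) \<in> C" "(b, q) \<in> C" using sides by blast
      with \<open>(a, b) \<in> C\<close> show ?thesis
        by (metis doubleton_eq_iff symC transC)
    qed (use that edgeC in auto)
    then have "adj E \<subseteq> (adj (E - r))\<^sup>*" by (auto simp: adj_def C_def)
    then have "(adj E)\<^sup>* \<subseteq> (adj (E - r))\<^sup>*" by (rule rtrancl_subset_rtrancl)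
    then have "connected_graph V (E - r)"
      using conn by (auto simp: connected_graph_def joined_iff_adj simple_graph_def)
    then show False using ncon by simp
  qed
  \<comment> \<open>An edge outside \<open>r\<close> has both ends inside or both outside the
    component of \<open>a\<close>; an edge of \<open>r\<close> has exactly one end inside.\<close>
  define P where "P v = (if (a, v) \<in> C then 0 else w)" for v
  show ?thesis
  proof
    fix x y assume xy: "{x, y} \<in> E"
    show "P y - P x = (if {x, y} \<in> r then \<rho> y - \<rho> x else 0)"
    proof (cases "{x, y} \<in> r")
      case True
      then obtain p q where pq: "{x, y} = {p, q}" "\<rho> q - \<rho> p = w" "(a, p) \<in> C" "(b, q) \<in> C"
        using sides by blast
      have "(a, q) \<notin> C" using pq nC symC transC by blast
      then have "P q - P p = w" using pq by (simp add: P_def)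
      with pq have "P y - P x = \<rho> y - \<rho> x" by (auto simp: doubleton_eq_iff algebra_simps)
      then show ?thesis using True by simp
    next
      case False
      then have "(a, x) \<in> C \<longleftrightarrow> (a, y) \<in> C" using edgeC[OF xy] symC transC by blast
      then show ?thesis using False by (simp add: P_def)
    qed
  qed
qed

text \<open>\<open>S\<close> contains each ribbon entirely or not at all, so the potentials of the
  ribbons inside \<open>S\<close> are added. There may be infinitely many ribbons; with all
  potentials normalized to vanish at a base vertex, only finitely many are nonzero at any given
  vertex.\<close>

lemma ribbon_union_potential:
  assumes cut: "ribbon_cutting_graph V E" and par: "parallelogram_placement V E \<rho>"
    and S: "\<And>e f. (e, f) \<in> opposite_edges E \<Longrightarrow> e \<in> S \<Longrightarrow> f \<in> S"
  obtains R :: "'v \<Rightarrow> real^2" where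
    "\<And>x y. {x, y} \<in> E \<Longrightarrow> R y - R x = (if {x, y} \<in> S then \<rho> y - \<rho> x else 0)"
proof -
  have conn: "connected_graph V E" using cut by (simp add: ribbon_cutting_graph_def)
  then have simple: "simple_graph V E" and "V \<noteq> {}" by (auto simp: connected_graph_def)
  then obtain z where z: "z \<in> V" by auto
  have "\<forall>r\<in>ribbons E. \<exists>P :: 'v \<Rightarrow> real^2.
      \<forall>x y. {x, y} \<in> E \<longrightarrow> P y - P x = (if {x, y} \<in> r then \<rho> y - \<rho> x else 0)"
    using ribbon_potential[OF cut par] by metis
  then obtain P :: "'v set set \<Rightarrow> 'v \<Rightarrow> real^2" where P: "\<And>r x y. r \<in> ribbons E \<Longrightarrow> {x, y} \<in> E \<Longrightarrow>
      P r y - P r x = (if {x, y} \<in> r then \<rho> y - \<rho> x else 0)"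
    by metis
  define Q where "Q v r = (if r \<in> ribbons E \<and> r \<subseteq> S then P r v - P r z else 0)" for v r
  define cls where "cls e = (opposite_edges E)\<^sup>* `` {e}" for e
  have cls_ribbon: "cls e \<in> ribbons E" if "e \<in> E" for e
    using that by (auto simp: ribbons_def cls_def quotient_def)
  have cls_unique: "r = cls e" if "r \<in> ribbons E" "e \<in> r" for r e
  proof -
    obtain f where "r = (opposite_edges E)\<^sup>* `` {f}"
      using \<open>r \<in> ribbons E\<close> unfolding ribbons_def by (auto elim: quotientE)
    moreover have "equiv UNIV ((opposite_edges E)\<^sup>*)"
      by (simp add: equiv_def refl_rtrancl trans_rtrancl sym_opposite_edges sym_rtrancl)
    ultimately show ?thesis using \<open>e \<in> r\<close> unfolding cls_def by (simp add: equiv_class_eq)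
  qed
  have cls_sub: "cls e \<subseteq> S \<longleftrightarrow> e \<in> S" for e
  proof
    assume "e \<in> S"
    have "f \<in> S" if "(e, f) \<in> (opposite_edges E)\<^sup>*" for f
      using that by (induction rule: rtrancl_induct) (use \<open>e \<in> S\<close> S in auto)
    then show "cls e \<subseteq> S" by (auto simp: cls_def)
  qed (auto simp: cls_def)
  \<comment> \<open>The increment of \<open>Q\<close> along one edge: it is supported on the single
    ribbon containing that edge.\<close>
  define D where "D x y r = (if r = cls {x, y} \<and> {x, y} \<in> S then \<rho> y - \<rho> x else 0)" for x y r
  have Q_step: "Q y = (\<lambda>r. Q x r + D x y r)" if "{x, y} \<in> E" for x y
  proof
    fix r
    have "{x, y} \<in> cls {x, y}" by (simp add: cls_def)
    then have "{x, y} \<in> r \<longleftrightarrow> r = cls {x, y}" if "r \<in> ribbons E"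
      using that cls_unique by blast
    then have "Q y r - Q x r = D x y r"
      using P[OF _ that, of r] cls_sub[of "{x, y}"] cls_ribbon[OF that]
      by (cases "r \<in> ribbons E"; cases "r = cls {x, y}") (simp_all add: Q_def D_def)
    then show "Q y r = Q x r + D x y r" by (simp add: algebra_simps)
  qed
  have finD: "finite {r. D x y r \<noteq> 0}" for x y
    by (rule finite_subset[of _ "{cls {x, y}}"]) (auto simp: D_def)
  \<comment> \<open>Along a walk from \<open>z\<close>, where \<open>Q\<close> vanishes, each edge
    enlarges the support by at most one ribbon. \<open>Sum_any\<close> is additive only under such
    finiteness.\<close>
  have finQ: "finite {r. Q v r \<noteq> 0}" if "v \<in> V" for v
  proof -
    have "(z, v) \<in> (adj E)\<^sup>*"
      using conn z that by (auto simp: connected_graph_def joined_iff_adj)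
    then show ?thesis
    proof (induction rule: rtrancl_induct)
      case base
      have "Q z r = 0" for r by (simp add: Q_def)
      then show ?case by simp
    next
      case (step x y)
      have "{r. Q y r \<noteq> 0} \<subseteq> {r. Q x r \<noteq> 0} \<union> {r. D x y r \<noteq> 0}"
        using \<open>(x, y) \<in> adj E\<close> by (auto simp: adj_def Q_step)
      then show ?case using step.IH finD finite_subset by blast
    qed
  qed
  show ?thesis
  proof
    fix x y assume xy: "{x, y} \<in> E"
    then have "x \<in> V" using simple_graph_edge[OF simple] by blast
    have "Sum_any (Q y) = Sum_any (Q x) + Sum_any (D x y)"
      using Sum_any.distrib[OF finQ[OF \<open>x \<in> V\<close>] finD[of x y]] Q_step[OF xy] by simp
    moreover have "Sum_any (D x y) = (if {x, y} \<in> S then \<rho> y - \<rho> x else 0)"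
    proof -
      have "Sum_any (D x y) = sum (D x y) {cls {x, y}}"
        by (rule Sum_any.expand_superset) (auto simp: D_def)
      then show ?thesis by (simp add: D_def)
    qed
    ultimately show "Sum_any (Q y) - Sum_any (Q x) = (if {x, y} \<in> S then \<rho> y - \<rho> x else 0)"
      by simp
  qed
qed

section \<open>Colors of triangles and 4-cycles\<close>

text \<open>Two edges of each color would require four edges.\<close>

lemma NAC_triangle:
  assumes "NAC_coloring E \<delta>" "graph_cycle E [a, b, c]"
  shows "\<delta> {a, b} = \<delta> {a, c}" "\<delta> {b, c} = \<delta> {a, c}"
proof -
  have "\<exists>k. \<forall>e\<in>cycle_edges [a, b, c]. \<delta> e = k"
  proof (rule ccontr)
    let ?X = "cycle_edges [a, b, c]"
    let ?A = "\<lambda>k. {e \<in> ?X. \<delta> e = k}"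
    assume "\<not> ?thesis"
    then have two: "card (?A k) \<ge> 2" for k
      using assms by (auto simp: NAC_coloring_def)
    have "card (?A Red) + card (?A Blue) = card (?A Red \<union> ?A Blue)"
      by (rule card_Un_disjoint[symmetric]) (auto simp: cycle_edges_3)
    also have "\<dots> \<le> card ?X" by (rule card_mono) (auto simp: cycle_edges_3)
    also have "\<dots> \<le> 3" by (simp add: cycle_edges_3 card_insert_if)
    finally show False using two[of Red] two[of Blue] by linarith
  qed
  then show "\<delta> {a, b} = \<delta> {a, c}" "\<delta> {b, c} = \<delta> {a, c}"
    by (auto simp: cycle_edges_3 insert_commute)
qed

text \<open>With different colors, the paths through \<open>b\<close> and through \<open>d\<close>
  would join \<open>a\<close> and \<open>c\<close> once in red and once in blue.\<close>

lemma not_red_blue_joined: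
  assumes cart: "cartesian_NAC_coloring V E \<delta>" and "simple_graph V E"
    and E: "{a, b} \<in> E" "{b, c} \<in> E" "{a, d} \<in> E" "{d, c} \<in> E" and "a \<noteq> c"
    and col: "\<delta> {a, b} = \<delta> {b, c}" "\<delta> {a, d} = \<delta> {d, c}"
  shows "\<delta> {a, b} = \<delta> {a, d}"
proof (rule ccontr)
  assume ne: "\<delta> {a, b} \<noteq> \<delta> {a, d}"
  have "a \<in> V" "c \<in> V" using E simple_graph_edge[OF \<open>simple_graph V E\<close>] by blast+
  have "joined {e \<in> E. \<delta> e = \<delta> {a, b}} a c"
    unfolding joined_iff_adj
    by (rule rtrancl_trans[of _ b]) (use E col in \<open>auto simp: adj_def\<close>)
  moreover have "joined {e \<in> E. \<delta> e = \<delta> {a, d}} a c"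
    unfolding joined_iff_adj
    by (rule rtrancl_trans[of _ d]) (use E col in \<open>auto simp: adj_def\<close>)
  ultimately have "joined {e \<in> E. \<delta> e = Red} a c \<and> joined {e \<in> E. \<delta> e = Blue} a c"
    using ne by (cases "\<delta> {a, b}"; cases "\<delta> {a, d}") auto
  then show False using cart \<open>a \<noteq> c\<close> \<open>a \<in> V\<close> \<open>c \<in> V\<close>
    unfolding cartesian_NAC_coloring_def by blast
qed

text \<open>A 4-cycle with differently colored opposite edges has two edges of each color, the
  equally colored ones being consecutive. They form a red and a blue path between the same two
  vertices, which a cartesian coloring forbids. Hence ribbons are monochromatic.\<close>

lemma cartesian_opposite:
  assumes cart: "cartesian_NAC_coloring V E \<delta>" and simple: "simple_graph V E"
    and cyc: "graph_cycle E [a, b, c, d]"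
  shows "\<delta> {a, b} = \<delta> {c, d}"
proof (rule ccontr)
  assume ne: "\<delta> {a, b} \<noteq> \<delta> {c, d}"
  let ?X = "cycle_edges [a, b, c, d]"
  have two: "card {e \<in> ?X. \<delta> e = k} \<ge> 2" for k
  proof -
    have "\<not> (\<exists>k. \<forall>e\<in>?X. \<delta> e = k)" using ne by (auto simp: cycle_edges_4)
    then show ?thesis
      using cart cyc by (auto simp: cartesian_NAC_coloring_def NAC_coloring_def)
  qed
  have not_single: "\<not> {e \<in> ?X. \<delta> e = k} \<subseteq> {f}" for k f
    using two[of k] card_mono[of "{f}" "{e \<in> ?X. \<delta> e = k}"] by force
  have E: "{a, b} \<in> E" "{b, c} \<in> E" "{c, d} \<in> E" "{d, a} \<in> E" and "a \<noteq> c" "b \<noteq> d"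
    using cyc by (auto simp: graph_cycle_4)
  \<comment> \<open>If they agreed, the colors would split three to one.\<close>
  have "\<delta> {b, c} \<noteq> \<delta> {d, a}"
  proof
    assume eq: "\<delta> {b, c} = \<delta> {d, a}"
    show False
    proof (cases "\<delta> {b, c} = \<delta> {a, b}")
      case True
      then have "{e \<in> ?X. \<delta> e = \<delta> {c, d}} \<subseteq> {{c, d}}" using eq ne by (auto simp: cycle_edges_4)
      then show False using not_single by blast
    next
      case False
      then have "{e \<in> ?X. \<delta> e = \<delta> {a, b}} \<subseteq> {{a, b}}" using eq ne by (auto simp: cycle_edges_4)
      then show False using not_single by blast
    qed
  qed
  \<comment> \<open>The color changes either at \<open>a\<close> and \<open>c\<close> or at
    \<open>b\<close> and \<open>d\<close>.\<close>
  then consider "\<delta> {a, b} = \<delta> {b, c}" "\<delta> {a, d} = \<delta> {d, c}"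
    | "\<delta> {b, a} = \<delta> {a, d}" "\<delta> {b, c} = \<delta> {c, d}"
    using ne
    by (cases "\<delta> {a, b}"; cases "\<delta> {b, c}"; cases "\<delta> {c, d}"; cases "\<delta> {d, a}")
      (auto simp: insert_commute)
  then show False
  proof cases
    case 1
    then have "\<delta> {a, b} = \<delta> {a, d}"
      using not_red_blue_joined[OF cart simple, of a b c d] E \<open>a \<noteq> c\<close> by (simp add: insert_commute)
    then show False using 1 ne by (simp add: insert_commute)
  next
    case 2
    then have "\<delta> {b, a} = \<delta> {b, c}"
      using not_red_blue_joined[OF cart simple, of b a d c] E \<open>b \<noteq> d\<close> by (simp add: insert_commute)
    then show False using 2 ne by (simp add: insert_commute)
  qed
qed

section \<open>Rotations of the plane\<close>

text \<open>The counterclockwise quarter turn; combining a vector with its image by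
  \<open>cos t\<close> and \<open>sin t\<close> rotates it by \<open>t\<close>.\<close>

definition perp :: "real^2 \<Rightarrow> real^2" where
  "perp x = vector [- x $ 2, x $ 1]"

lemma perp_diff: "perp (x - y) = perp x - perp y"
  by (simp add: perp_def vec_eq_iff forall_2)

lemma norm_sq_2: "(norm (x :: real^2))\<^sup>2 = (x $ 1)\<^sup>2 + (x $ 2)\<^sup>2"
  by (simp add: power2_norm_eq_inner inner_vec_def sum_2 flip: power2_eq_square)

lemma norm_rotate: "norm (cos t *\<^sub>R x + sin t *\<^sub>R perp x) = norm x"
proof -
  have "(norm (cos t *\<^sub>R x + sin t *\<^sub>R perp x))\<^sup>2 =
      ((cos t)\<^sup>2 + (sin t)\<^sup>2) * ((x $ 1)\<^sup>2 + (x $ 2)\<^sup>2)"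
    unfolding norm_sq_2 perp_def vector_add_component vector_scaleR_component vector_2 real_scaleR_def
    by algebra
  also have "\<dots> = (norm x)\<^sup>2" by (simp add: norm_sq_2)
  finally show ?thesis by (simp add: power2_eq_iff_nonneg)
qed

text \<open>
  The squared lengths are \<open>|x|\<^sup>2 + |y|\<^sup>2\<close> plus \<open>2 x\<cdot>y\<close>, \<open>- 2 x\<cdot>y\<close> and \<open>2 x\<cdot>(perp y)\<close>, so the
  hypotheses say that \<open>x\<close> is orthogonal to both \<open>y\<close> and \<open>perp y\<close>.
\<close>

lemma rotation_changes_norm:
  assumes "norm (x - y) = norm (x + y)" "norm (x + perp y) = norm (x + y)"
  shows "x = 0 \<or> y = 0"
proof -
  have "(norm (x - y))\<^sup>2 = (norm (x + y))\<^sup>2" "(norm (x + perp y))\<^sup>2 = (norm (x + y))\<^sup>2"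
    using assms by simp_all
  then have "x $ 1 * y $ 1 + x $ 2 * y $ 2 = 0" "x $ 2 * y $ 1 - x $ 1 * y $ 2 = 0"
    unfolding norm_sq_2 by (simp_all add: perp_def power2_eq_square algebra_simps)
  \<comment> \<open>The two-square identity: both terms on the right vanish, hence so does the
    product of the squared norms.\<close>
  moreover have "((x $ 1)\<^sup>2 + (x $ 2)\<^sup>2) * ((y $ 1)\<^sup>2 + (y $ 2)\<^sup>2) =
      (x $ 1 * y $ 1 + x $ 2 * y $ 2)\<^sup>2 + (x $ 2 * y $ 1 - x $ 1 * y $ 2)\<^sup>2"
    by (simp add: power2_eq_square algebra_simps)
  ultimately have "(norm x)\<^sup>2 * (norm y)\<^sup>2 = 0"
    unfolding norm_sq_2 by simp
  then show ?thesis by simp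
qed

section \<open>The flex\<close>

text \<open>If no vertex met both colors, having a red edge would propagate along a walk from
  \<open>a\<close> to \<open>c\<close>, but \<open>c\<close> lies on a blue edge.\<close>

lemma two_colored_vertex:
  assumes conn: "connected_graph V E" and ab: "{a, b} \<in> E" "\<delta> {a, b} = Red"
    and cd: "{c, d} \<in> E" "\<delta> {c, d} = Blue"
  obtains x y z where "{x, y} \<in> E" "\<delta> {x, y} = Red" "{y, z} \<in> E" "\<delta> {y, z} = Blue"
proof -
  have "a \<in> V" "c \<in> V"
    using ab cd conn simple_graph_edge[of V E] by (auto simp: connected_graph_def)
  then have ac: "(a, c) \<in> (adj E)\<^sup>*"
    using conn by (simp add: connected_graph_def joined_iff_adj)
  have "\<exists>x y z. {x, y} \<in> E \<and> \<delta> {x, y} = Red \<and> {y, z} \<in> E \<and> \<delta> {y, z} = Blue"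
  proof (rule ccontr)
    assume none: "\<not> ?thesis"
    from ac have "\<exists>x. {x, c} \<in> E \<and> \<delta> {x, c} = Red"
    proof (induction rule: rtrancl_induct)
      case base
      have "{b, a} \<in> E" "\<delta> {b, a} = Red" using ab by (simp_all add: insert_commute)
      then show ?case by blast
    next
      case (step y z)
      then have "{y, z} \<in> E" by (simp add: adj_def)
      with step.IH none have "\<delta> {y, z} \<noteq> Blue" by blast
      then have "\<delta> {y, z} = Red" by (cases "\<delta> {y, z}") auto
      then show ?case using \<open>{y, z} \<in> E\<close> by blast
    qed
    then show False using none cd by blast
  qed
  then show thesis using that by blast
qed

theorem theorem4p4:
  fixes V :: "'v set" and Ec Ed :: "'v set set" and \<rho> :: "'v \<Rightarrow> real^2"
  assumes "braced_P_framework V Ec Ed \<rho>"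
    and "\<exists>\<delta>. cartesian_NAC_coloring V (Ec \<union> Ed) \<delta>"
  shows "flexible V (Ec \<union> Ed) \<rho>"
proof -
  let ?E = "Ec \<union> Ed"
  obtain \<delta> where cart: "cartesian_NAC_coloring V ?E \<delta>" using assms(2) by blast
  then have nac: "NAC_coloring ?E \<delta>" by (simp add: cartesian_NAC_coloring_def)
  have cut: "ribbon_cutting_graph V Ec" and par: "parallelogram_placement V Ec \<rho>"
    and simple: "simple_graph V ?E" and plc: "placement V ?E \<rho>"
    and braces: "\<And>e. e \<in> Ed \<Longrightarrow> \<exists>u1 u2 u3 u4. graph_cycle Ec [u1, u2, u3, u4] \<and> e = {u1, u3}"
    using assms(1)
    by (auto simp: braced_P_framework_def braced_ribbon_cutting_graph_def framework_def
        connected_graph_def)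
  have conn: "connected_graph V Ec" using cut by (simp add: ribbon_cutting_graph_def)
  have "f \<in> {e. \<delta> e = Red}" if "(e, f) \<in> opposite_edges Ec" "e \<in> {e. \<delta> e = Red}" for e f
  proof -
    obtain a b c d where "e = {a, b}" "f = {c, d}" "graph_cycle Ec [a, b, c, d]"
      using \<open>(e, f) \<in> opposite_edges Ec\<close> by (auto simp: opposite_edges_def)
    moreover from this have "graph_cycle ?E [a, b, c, d]" by (auto simp: graph_cycle_4)
    ultimately show ?thesis using cartesian_opposite[OF cart simple] that by auto
  qed
  then obtain R :: "'v \<Rightarrow> real^2" where RC: "\<And>x y. {x, y} \<in> Ec \<Longrightarrow>
      R y - R x = (if {x, y} \<in> {e. \<delta> e = Red} then \<rho> y - \<rho> x else 0)"
    using ribbon_union_potential[OF cut par, of "{e. \<delta> e = Red}"] by metis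
  \<comment> \<open>A brace closes a triangle with two sides of its 4-cycle, and triangles are
    monochromatic.\<close>
  have brace_color: "\<exists>v. {x, v} \<in> Ec \<and> {v, y} \<in> Ec \<and> \<delta> {x, v} = \<delta> {x, y} \<and> \<delta> {v, y} = \<delta> {x, y}"
    if "{x, y} \<in> Ed" for x y
  proof -
    obtain u1 u2 u3 u4 where u: "graph_cycle Ec [u1, u2, u3, u4]" "{x, y} = {u1, u3}"
      using braces[OF \<open>{x, y} \<in> Ed\<close>] by blast
    then have "graph_cycle ?E [x, u2, y]" "{x, u2} \<in> Ec" "{u2, y} \<in> Ec"
      using \<open>{x, y} \<in> Ed\<close> by (auto simp: graph_cycle_3 graph_cycle_4 doubleton_eq_iff insert_commute)
    then show ?thesis using NAC_triangle[OF nac] by blast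
  qed
  \<comment> \<open>For a brace, the equations of the two equally colored sides add up.\<close>
  have R: "R y - R x = (if \<delta> {x, y} = Red then \<rho> y - \<rho> x else 0)" if "{x, y} \<in> ?E" for x y
  proof (cases "{x, y} \<in> Ec")
    case False
    then obtain v where "{x, v} \<in> Ec" "{v, y} \<in> Ec" "\<delta> {x, v} = \<delta> {x, y}" "\<delta> {v, y} = \<delta> {x, y}"
      using brace_color \<open>{x, y} \<in> ?E\<close> by blast
    then show ?thesis using RC[of x v] RC[of v y] by (auto simp: algebra_simps split: if_splits)
  qed (simp add: RC)
  have color_c: "\<exists>a b. {a, b} \<in> Ec \<and> \<delta> {a, b} = k" for k
  proof -
    have "k \<in> \<delta> ` ?E" using nac by (cases k) (auto simp: NAC_coloring_def)
    then obtain e where "e \<in> ?E" "\<delta> e = k" by blast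
    then obtain a b where "{a, b} \<in> ?E" "\<delta> {a, b} = k"
      using simple unfolding simple_graph_def by blast
    then show ?thesis using brace_color by blast
  qed
  \<comment> \<open>The factor \<open>pi\<close> makes the parameters \<open>1 / 2\<close> and
    \<open>1\<close> a quarter and a half turn, the two rotations in
    \<open>rotation_changes_norm\<close>.\<close>
  define f where "f s v = R v + (cos (pi * s) *\<^sub>R (\<rho> v - R v) + sin (pi * s) *\<^sub>R perp (\<rho> v - R v))"
    for s v
  have f_diff: "f s y - f s x = (R y - R x) +
      (cos (pi * s) *\<^sub>R ((\<rho> y - \<rho> x) - (R y - R x)) +
       sin (pi * s) *\<^sub>R perp ((\<rho> y - \<rho> x) - (R y - R x)))" for s x y
    unfolding f_def perp_diff by (simp add: algebra_simps)
  have perp0: "perp 0 = 0" using perp_diff[of 0 0] by simp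
  have len: "norm (f s x - f s y) = norm (\<rho> x - \<rho> y)" if "{x, y} \<in> ?E" for s x y
  proof -
    \<comment> \<open>A red edge vector stays fixed and a blue one is rotated.\<close>
    have "norm (f s y - f s x) = norm (\<rho> y - \<rho> x)"
      unfolding f_diff R[OF that] by (simp add: norm_rotate perp0)
    then show ?thesis by (simp add: norm_minus_commute)
  qed
  have "flex V ?E \<rho> f"
    unfolding flex_def
  proof (intro conjI ballI impI)
    show "continuous_on {0..1} (\<lambda>s. f s v)" for v
      unfolding f_def by (intro continuous_intros)
    show "placement V ?E (f s)" for s
      unfolding placement_def
    proof (intro ballI impI)
      fix u v assume uv: "u \<in> V" "v \<in> V" "{u, v} \<in> ?E"
      then have "\<rho> u \<noteq> \<rho> v" using plc unfolding placement_def by blast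
      then have "norm (f s u - f s v) \<noteq> 0" using len[OF uv(3)] by simp
      then show "f s u \<noteq> f s v" by auto
    qed
    show "f 0 v = \<rho> v" for v by (simp add: f_def)
  qed (rule len)
  moreover have "\<not> trivial_flex V \<rho> f"
  proof
    assume "trivial_flex V \<rho> f"
    then have cong: "congruent_placements V \<rho> (f s)" if "s \<in> {0..1}" for s
      using that by (simp add: trivial_flex_def)
    \<comment> \<open>At \<open>y\<close> the blue edge turns against the red one, so the distance
      from \<open>x\<close> to \<open>z\<close> should vary; a trivial flex would keep it
      constant.\<close>
    obtain x y z where xyz: "{x, y} \<in> Ec" "\<delta> {x, y} = Red" "{y, z} \<in> Ec" "\<delta> {y, z} = Blue"
      using color_c[of Red] color_c[of Blue] two_colored_vertex[OF conn] by metis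
    then have V: "x \<in> V" "y \<in> V" "z \<in> V" and E: "{x, y} \<in> ?E" "{y, z} \<in> ?E"
      using simple_graph_edge[OF simple] by auto
    let ?a = "\<rho> y - \<rho> x" and ?b = "\<rho> z - \<rho> y"
    have Rxz: "R z - R x = ?a" using R[OF E(1)] R[OF E(2)] xyz by (simp add: algebra_simps)
    have "(\<rho> z - \<rho> x) - ?a = ?b" "\<rho> z - \<rho> x = ?a + ?b" by simp_all
    moreover have "norm (f s z - f s x) = norm (\<rho> z - \<rho> x)" if "s \<in> {0..1}" for s
      using cong[OF that] V by (auto simp: congruent_placements_def dist_norm)
    ultimately have "norm (?a + (cos (pi * s) *\<^sub>R ?b + sin (pi * s) *\<^sub>R perp ?b)) = norm (?a + ?b)"
      if "s \<in> {0..1}" for s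
      using that unfolding f_diff Rxz by metis
    \<comment> \<open>The rotated \<open>?b\<close> is \<open>- ?b\<close> at parameter 1 and
      \<open>perp ?b\<close> at \<open>1 / 2\<close>.\<close>
    from this[of 1] this[of "1 / 2"] have "?a = 0 \<or> ?b = 0"
      by (intro rotation_changes_norm) simp_all
    moreover have "\<rho> x \<noteq> \<rho> y" "\<rho> y \<noteq> \<rho> z" using plc V E unfolding placement_def by blast+
    ultimately show False by simp
  qed
  ultimately show ?thesis unfolding flexible_def by blast
qed

end
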